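(* Let $K$ be a field. For $p,q\in K^*$ let $G\mathcal{H}_{p,q}$ be the $K$-algebra generated by $t,x,y$ subject to the relations $$yx-qxy=t,\qquad xt=ptx,\qquad yt=p^{-1}ty,$$ and for $f\in K[t]$ let $\mathcal{H}(f)$ be the $K$-algebra with generators $x,y,t$ and defining relations $$tx=xf,\qquad yt=fy,\qquad yx-xy=f-t.$$ Then, for $p,q\in K^*$, the algebra $G\mathcal{H}_{p,q}$ is isomorphic (as a $K$-algebra) to $\mathcal{H}(f)$ for some $f\in K[t]$ if and only if either $p=1$ or $q=1$, but not both. In particular, $G\mathcal{H}_{1,1}$, which is the enveloping algebra of the 3-dimensional Heisenberg Lie algebra, is not isomorphic to $\mathcal{H}(f)$ for any $f\in K[t]$.
   Context: Algebras are associative unital $K$-algebras; $K^*=K\setminus\{0\}$. $G\mathcal{H}_{p,q}$ is called the Gaddis two-parameter quantum Heisenberg algebra and $\mathcal{H}(f)$ the generalized Heisenberg algebra associated to $f$. *)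

theory Defs
  imports
    "HOL-Algebra.Module"
    "HOL-Algebra.QuotRing"
    "HOL-Algebra.Algebraic_Closure_Type"
    "HOL-Computational_Algebra.Polynomial"
    "HOL-Library.Poly_Mapping"
    "HOL-Library.Product_Plus"
begin

section \<open>Free algebras\<close>

text \<open>
  The free monoid on a set of generators, written additively so that it can serve as the
  exponent monoid of \<^typ>\<open>'a \<Rightarrow>\<^sub>0 'b\<close>, whose multiplication is convolution.
  Hence \<open>'g free_monoid \<Rightarrow>\<^sub>0 'k\<close> is the monoid algebra of the free monoid, i.e. the
  free associative unital algebra on \<open>'g\<close>.
\<close>

datatype 'g free_monoid = Word (letters: "'g list")

instantiation free_monoid :: (type) monoid_add
begin

definition zero_free_monoid :: "'g free_monoid" where
  "zero_free_monoid = Word []"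

definition plus_free_monoid :: "'g free_monoid \<Rightarrow> 'g free_monoid \<Rightarrow> 'g free_monoid" where
  "plus_free_monoid u v = Word (letters u @ letters v)"

instance
  by standard (simp_all add: zero_free_monoid_def plus_free_monoid_def)

end

type_synonym ('g, 'k) free_algebra = "'g free_monoid \<Rightarrow>\<^sub>0 'k"

definition scalar :: "'k::field \<Rightarrow> ('g, 'k) free_algebra" where
  "scalar c = Poly_Mapping.single 0 c"

definition gen :: "'g \<Rightarrow> ('g, 'k::field) free_algebra" where
  "gen g = Poly_Mapping.single (Word [g]) 1"

text \<open>
  Evaluation at an element of a free algebra; \<^const>\<open>poly\<close> itself is only available for
  commutative rings.
\<close>

definition poly_at :: "'k::field poly \<Rightarrow> ('g, 'k) free_algebra \<Rightarrow> ('g, 'k) free_algebra" where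
  "poly_at f a = (\<Sum>i\<le>Polynomial.degree f. scalar (Polynomial.coeff f i) * a ^ i)"


section \<open>Algebras given by generators and relations\<close>

text \<open>
  An algebra over the field \<open>'k\<close> is represented by the record type of modules, which extends
  that of rings by a scalar multiplication. (The locale \<^locale>\<open>algebra\<close> requires
  commutativity and is not used.) The ideals of \<^const>\<open>genideal\<close> are two-sided.
\<close>

definition presented_algebra ::
    "('g, 'k::field) free_algebra set \<Rightarrow> ('k, ('g, 'k) free_algebra set) module" where
  "presented_algebra S =
    (let F = ring_of_type_algebra;
         I = genideal F S;
         Q = F Quot I
     in ring.extend Q (module.fields (\<lambda>c A. (I +>\<^bsub>F\<^esub> scalar c) \<otimes>\<^bsub>Q\<^esub> A)))"

definition algebra_iso :: "('k, 'a) module \<Rightarrow> ('k, 'b) module \<Rightarrow> ('a \<Rightarrow> 'b) set" where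
  "algebra_iso A B =
    {h \<in> ring_iso A B. \<forall>c. \<forall>a\<in>carrier A. h (c \<odot>\<^bsub>A\<^esub> a) = c \<odot>\<^bsub>B\<^esub> h a}"

definition algebra_isomorphic :: "('k, 'a) module \<Rightarrow> ('k, 'b) module \<Rightarrow> bool" where
  "algebra_isomorphic A B \<longleftrightarrow> algebra_iso A B \<noteq> {}"


section \<open>The two families of algebras\<close>

datatype generator = Gen_t | Gen_x | Gen_y

definition gaddis_heisenberg ::
    "'k::field \<Rightarrow> 'k \<Rightarrow> ('k, (generator, 'k) free_algebra set) module" where
  "gaddis_heisenberg p q =
    (let t = gen Gen_t; x = gen Gen_x; y = gen Gen_y
     in presented_algebra
          {y * x - scalar q * x * y - t,
           x * t - scalar p * t * x,
           y * t - scalar (inverse p) * t * y})"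

definition generalized_heisenberg ::
    "'k::field poly \<Rightarrow> ('k, (generator, 'k) free_algebra set) module" where
  "generalized_heisenberg f =
    (let t = gen Gen_t; x = gen Gen_x; y = gen Gen_y
     in presented_algebra
          {t * x - x * poly_at f t,
           y * t - poly_at f t * y,
           y * x - x * y - (poly_at f t - t)})"


section \<open>Enveloping algebras\<close>

locale lie_algebra = vector_space scale
  for scale :: "'k::field \<Rightarrow> 'v::ab_group_add \<Rightarrow> 'v" +
  fixes bracket :: "'v \<Rightarrow> 'v \<Rightarrow> 'v"
  assumes bracket_add_left: "bracket (u + v) w = bracket u w + bracket v w"
    and bracket_add_right: "bracket u (v + w) = bracket u v + bracket u w"
    and bracket_scale_left: "bracket (scale c u) v = scale c (bracket u v)"
    and bracket_scale_right: "bracket u (scale c v) = scale c (bracket u v)"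
    and bracket_self: "bracket u u = 0"
    and jacobi: "bracket u (bracket v w) + bracket v (bracket w u) + bracket w (bracket u v) = 0"

text \<open>
  The generators are all vectors of the Lie algebra. The first two families of relations make
  the generators linear in the vector, which turns the free algebra on the underlying set into
  the tensor algebra.
\<close>

definition enveloping_algebra ::
    "('k::field \<Rightarrow> 'v::ab_group_add \<Rightarrow> 'v) \<Rightarrow> ('v \<Rightarrow> 'v \<Rightarrow> 'v)
      \<Rightarrow> ('k, ('v, 'k) free_algebra set) module" where
  "enveloping_algebra scale bracket =
    presented_algebra
      ({gen (u + v) - (gen u + gen v) |u v. True} \<union>
       {gen (scale c u) - scalar c * gen u |c u. True} \<union>
       {gen u * gen v - gen v * gen u - gen (bracket u v) |u v. True})"

text \<open>
  The 3-dimensional Heisenberg Lie algebra on \<open>'k \<times> 'k \<times> 'k\<close>: the standard basis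
  \<open>X, Y, Z\<close> satisfies \<open>[X, Y] = Z\<close>, and \<open>Z\<close> is central.
\<close>

definition triple_scale :: "'k::field \<Rightarrow> 'k \<times> 'k \<times> 'k \<Rightarrow> 'k \<times> 'k \<times> 'k" where
  "triple_scale c = (\<lambda>(a, b, z). (c * a, c * b, c * z))"

definition heisenberg_bracket ::
    "'k::field \<times> 'k \<times> 'k \<Rightarrow> 'k \<times> 'k \<times> 'k \<Rightarrow> 'k \<times> 'k \<times> 'k" where
  "heisenberg_bracket = (\<lambda>(a, b, z) (a', b', z'). (0, 0, a * b' - b * a'))"

lemma lie_algebra_heisenberg:
  "lie_algebra (triple_scale :: 'k::field \<Rightarrow> _) heisenberg_bracket"
  by unfold_locales
    (auto simp: triple_scale_def heisenberg_bracket_def zero_prod_def algebra_simps)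

end

theory Submission
  imports Defs
begin

text \<open>
  If \<open>q = 1 \<noteq> p\<close>, rescaling \<open>t\<close> by \<open>p\<^sup>-\<^sup>1 - 1\<close> identifies \<open>GH\<^sub>p\<^sub>,\<^sub>1\<close> with \<open>H(p\<^sup>-\<^sup>1t)\<close>; if \<open>p = 1 \<noteq> q\<close>, the
  substitution \<open>t \<mapsto> (1 - q)(xy - t)\<close> identifies \<open>GH\<^sub>1\<^sub>,\<^sub>q\<close> with \<open>H(qt)\<close>.

  Conversely, the character \<open>t = x = y = 0\<close> of \<open>GH\<^sub>p\<^sub>,\<^sub>q\<close> yields, through an isomorphism with \<open>H(f)\<close>, a
  fixed point \<open>r\<close> of \<open>f\<close>, so that \<open>t \<mapsto> r\<close> maps \<open>H(f)\<close> onto the polynomial ring \<open>K[x, y]\<close>. If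
  \<open>p \<noteq> 1\<close> and \<open>q \<noteq> 1\<close>, the relations of \<open>GH\<^sub>p\<^sub>,\<^sub>q\<close> in a commutative domain force \<open>t = 0\<close> and \<open>xy = 0\<close>, and
  \<open>K[x, y]\<close> would be generated by a single element. For \<open>p = q = 1\<close>, the case \<open>f'(r) \<noteq> 1\<close> is excluded by
  a representation of \<open>H(f)\<close> by upper triangular matrices. If \<open>f'(r) = 1\<close>, the tangent space of \<open>H(f)\<close>
  at the character \<open>(r, 0, 0)\<close> is three-dimensional, but every commutative quotient of \<open>GH\<^sub>1\<^sub>,\<^sub>1\<close> is
  generated by two elements.
\<close>

section \<open>Evaluation homomorphisms of free algebras\<close>

text \<open>The map given by the universal property of the free algebra: \<open>h\<close> lists the
  images of the generators and \<open>\<iota>\<close> is the structure map of the target. It is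
  multiplicative once \<open>\<iota>\<close> is a central homomorphism.\<close>

definition alg_eval :: "('k::field \<Rightarrow> 'r::ring_1) \<Rightarrow> ('g \<Rightarrow> 'r) \<Rightarrow> ('g, 'k) free_algebra \<Rightarrow> 'r" where
  "alg_eval \<iota> h a =
    (\<Sum>w\<in>Poly_Mapping.keys a. \<iota> (Poly_Mapping.lookup a w) * prod_list (map h (letters w)))"

lemma scalar_add: "scalar (c + d) = scalar c + scalar d"
  by (simp add: scalar_def single_add)

lemma scalar_mult: "scalar (c * d) = scalar c * scalar d"
  by (simp add: scalar_def mult_single)

lemma scalar_one [simp]: "scalar 1 = 1"
  by (simp add: scalar_def)

lemma scalar_zero [simp]: "scalar 0 = 0"
  by (simp add: scalar_def)

lemma gen_mult_single: "gen g * Poly_Mapping.single (Word w) c = Poly_Mapping.single (Word (g # w)) c"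
  by (simp add: gen_def mult_single plus_free_monoid_def)

lemma free_algebra_induct_single [case_names single add]:
  fixes a :: "('g, 'k::field) free_algebra"
  assumes "\<And>w c. P (Poly_Mapping.single w c)" and "\<And>a b. P a \<Longrightarrow> P b \<Longrightarrow> P (a + b)"
  shows "P a"
proof (induction a rule: Poly_Mapping.update_induct)
  case const
  show ?case using assms(1)[of 0 0] by simp
next
  case (update a w c)
  have "Poly_Mapping.update w c a = a + Poly_Mapping.single w c"
    using update.hyps(1)
    by (intro poly_mapping_eqI)
      (auto simp: lookup_update lookup_add lookup_single in_keys_iff when_def)
  then show ?case
    using assms update.IH by simp
qed

lemma free_algebra_induct [case_names scalar gen_mult add]:
  fixes a :: "('g, 'k::field) free_algebra"
  assumes "\<And>c. P (scalar c)" and "\<And>g a. P a \<Longrightarrow> P (gen g * a)"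
    and "\<And>a b. P a \<Longrightarrow> P b \<Longrightarrow> P (a + b)"
  shows "P a"
proof (induction a rule: free_algebra_induct_single)
  case (single w c)
  have "P (Poly_Mapping.single (Word u) c)" for u
  proof (induction u)
    case Nil
    show ?case using assms(1)[of c] by (simp add: scalar_def zero_free_monoid_def)
  next
    case (Cons g u)
    then show ?case using assms(2)[of _ g] by (simp add: gen_mult_single[symmetric])
  qed
  then show ?case by (metis free_monoid.exhaust)
qed (use assms in auto)

lemma scalar_central: "a * scalar c = scalar c * a"
proof (induction a rule: free_algebra_induct_single)
  case (single w d)
  then show ?case by (simp add: scalar_def mult_single mult.commute)
qed (simp add: algebra_simps)

text \<open>A unital ring homomorphism from \<open>'k\<close> into the centre of \<open>'r\<close>
  is the same as a \<open>'k\<close>-algebra structure on \<open>'r\<close>.\<close>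

locale central_hom =
  fixes \<iota> :: "'k::field \<Rightarrow> 'r::ring_1"
  assumes add: "\<iota> (c + d) = \<iota> c + \<iota> d"
    and mult: "\<iota> (c * d) = \<iota> c * \<iota> d"
    and one: "\<iota> 1 = 1"
    and central: "a * \<iota> c = \<iota> c * a"
begin

lemma zero: "\<iota> 0 = 0"
  using add[of 0 0] by simp

lemma left_central: "a * (\<iota> c * b) = \<iota> c * (a * b)"
  by (metis central mult.assoc)

lemma alg_eval_zero [simp]: "alg_eval \<iota> h 0 = 0"
  by (simp add: alg_eval_def)

lemma alg_eval_single:
  "alg_eval \<iota> h (Poly_Mapping.single w c) = \<iota> c * prod_list (map h (letters w))"
  by (cases "c = 0") (simp_all add: alg_eval_def zero)

lemma alg_eval_superset:
  assumes "finite A" and "Poly_Mapping.keys a \<subseteq> A"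
  shows "alg_eval \<iota> h a = (\<Sum>w\<in>A. \<iota> (Poly_Mapping.lookup a w) * prod_list (map h (letters w)))"
  unfolding alg_eval_def
  by (rule sum.mono_neutral_left) (use assms in \<open>auto simp: in_keys_iff zero\<close>)

lemma alg_eval_add [simp]: "alg_eval \<iota> h (a + b) = alg_eval \<iota> h a + alg_eval \<iota> h b"
proof -
  let ?A = "Poly_Mapping.keys a \<union> Poly_Mapping.keys b"
  have "Poly_Mapping.keys (a + b) \<subseteq> ?A" by (rule keys_add)
  then show ?thesis
    by (simp add: alg_eval_superset[where A = ?A] lookup_add add distrib_right sum.distrib)
qed

lemma alg_eval_uminus [simp]: "alg_eval \<iota> h (- a) = - alg_eval \<iota> h a"
  using alg_eval_add[of h a "- a"] by (simp add: eq_neg_iff_add_eq_0 add.commute)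

lemma alg_eval_diff [simp]: "alg_eval \<iota> h (a - b) = alg_eval \<iota> h a - alg_eval \<iota> h b"
  using alg_eval_add[of h a "- b"] by simp

lemma alg_eval_scalar [simp]: "alg_eval \<iota> h (scalar c) = \<iota> c"
  by (simp add: scalar_def alg_eval_single zero_free_monoid_def)

lemma alg_eval_gen [simp]: "alg_eval \<iota> h (gen g) = h g"
  by (simp add: gen_def alg_eval_single one)

lemma alg_eval_mult [simp]: "alg_eval \<iota> h (a * b) = alg_eval \<iota> h a * alg_eval \<iota> h b"
proof (induction a rule: free_algebra_induct_single)
  case (single w c)
  show ?case
  proof (induction b rule: free_algebra_induct_single)
    case (single v d)
    show ?case
      using left_central[of "prod_list (map h (letters w))" d "prod_list (map h (letters v))"]
      by (simp add: mult_single alg_eval_single mult plus_free_monoid_def mult.assoc)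
  qed (simp add: distrib_left)
qed (simp add: distrib_right)

lemma alg_eval_one [simp]: "alg_eval \<iota> h 1 = 1"
  using alg_eval_scalar[of h 1] one by simp

lemma alg_eval_power [simp]: "alg_eval \<iota> h (a ^ n) = alg_eval \<iota> h a ^ n"
  by (induction n) simp_all

lemma alg_eval_sum [simp]: "alg_eval \<iota> h (sum f A) = (\<Sum>i\<in>A. alg_eval \<iota> h (f i))"
  by (induction A rule: infinite_finite_induct) simp_all

end

text \<open>Makes \<open>alg_eval scalar g\<close> the substitution of \<open>g\<close> for the
  generators, the form in which maps between presented algebras are handled.\<close>

interpretation scalar: central_hom scalar
  by unfold_locales (rule scalar_add scalar_mult scalar_one scalar_central)+

context central_hom
begin

lemma alg_eval_alg_eval:
  "alg_eval \<iota> h (alg_eval scalar g a) = alg_eval \<iota> (\<lambda>i. alg_eval \<iota> h (g i)) a"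
  by (induction a rule: free_algebra_induct) simp_all

lemma range_alg_eval_subset:
  assumes "\<And>c. \<iota> c \<in> B" and "\<And>g. h g \<in> B"
    and "\<And>u v. u \<in> B \<Longrightarrow> v \<in> B \<Longrightarrow> u + v \<in> B" and "\<And>u v. u \<in> B \<Longrightarrow> v \<in> B \<Longrightarrow> u * v \<in> B"
  shows "range (alg_eval \<iota> h) \<subseteq> B"
proof -
  have "alg_eval \<iota> h a \<in> B" for a
    by (induction a rule: free_algebra_induct) (use assms in auto)
  then show ?thesis by blast
qed

end

section \<open>Homomorphisms of presented algebras\<close>

abbreviation free_ring :: "('g, 'k::field) free_algebra ring" where
  "free_ring \<equiv> ring_of_type_algebra"

abbreviation relation_ideal :: "('g, 'k::field) free_algebra set \<Rightarrow> ('g, 'k) free_algebra set" where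
  "relation_ideal S \<equiv> genideal free_ring S"

abbreviation residue_class ::
    "('g, 'k::field) free_algebra set \<Rightarrow> ('g, 'k) free_algebra \<Rightarrow> ('g, 'k) free_algebra set" where
  "residue_class S a \<equiv> relation_ideal S +>\<^bsub>free_ring\<^esub> a"

lemma ring_of_type_algebra_simps [simp]:
  "carrier ring_of_type_algebra = UNIV"
  "x \<otimes>\<^bsub>ring_of_type_algebra\<^esub> y = x * y"
  "\<one>\<^bsub>ring_of_type_algebra\<^esub> = 1"
  "\<zero>\<^bsub>ring_of_type_algebra\<^esub> = 0"
  "x \<oplus>\<^bsub>ring_of_type_algebra\<^esub> y = x + y"
  by (simp_all add: ring_of_type_algebra_def)

lemma ring_ring_of_type_algebra: "ring (ring_of_type_algebra :: 'a::ring_1 ring)"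
proof -
  have "\<exists>y. x + y = 0" for x :: 'a
    using add.right_inverse by blast
  then show ?thesis
    unfolding ring_of_type_algebra_def using add.right_inverse
    by unfold_locales (auto simp: algebra_simps Units_def)
qed

interpretation free_ring: ring "free_ring :: ('g, 'k::field) free_algebra ring"
  by (rule ring_ring_of_type_algebra)

lemma ideal_relation_ideal: "ideal (relation_ideal S) free_ring"
  by (rule free_ring.genideal_ideal) simp

lemma relation_ideal_closed:
  shows relation_ideal_add: "a \<in> relation_ideal S \<Longrightarrow> b \<in> relation_ideal S \<Longrightarrow> a + b \<in> relation_ideal S"
    and relation_ideal_mult_left: "a \<in> relation_ideal S \<Longrightarrow> c * a \<in> relation_ideal S"
    and relation_ideal_mult_right: "a \<in> relation_ideal S \<Longrightarrow> a * c \<in> relation_ideal S"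
    and relation_ideal_zero: "0 \<in> relation_ideal S"
proof -
  interpret ideal "relation_ideal S" free_ring by (rule ideal_relation_ideal)
  show "a \<in> relation_ideal S \<Longrightarrow> b \<in> relation_ideal S \<Longrightarrow> a + b \<in> relation_ideal S"
    using a_closed[of a b] by simp
  show "a \<in> relation_ideal S \<Longrightarrow> c * a \<in> relation_ideal S"
    using I_l_closed[of a c] by simp
  show "a \<in> relation_ideal S \<Longrightarrow> a * c \<in> relation_ideal S"
    using I_r_closed[of a c] by simp
  show "0 \<in> relation_ideal S"
    using zero_closed by simp
qed

lemma relation_ideal_base: "a \<in> S \<Longrightarrow> a \<in> relation_ideal S"
  using free_ring.genideal_self[of S] by auto

lemma relation_ideal_diff:
  assumes "a \<in> relation_ideal S" and "b \<in> relation_ideal S"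
  shows "a - b \<in> relation_ideal S"
  using relation_ideal_add[OF assms(1) relation_ideal_mult_left[OF assms(2), of "- 1"]] by simp

lemma mem_residue_class_iff: "b \<in> residue_class S a \<longleftrightarrow> b - a \<in> relation_ideal S"
  by (auto simp: a_r_coset_def' algebra_simps intro: bexI[of _ "b - a"])

lemma residue_class_eq_iff: "residue_class S a = residue_class S b \<longleftrightarrow> a - b \<in> relation_ideal S"
proof
  assume "residue_class S a = residue_class S b"
  moreover have "a \<in> residue_class S a"
    by (simp add: mem_residue_class_iff relation_ideal_zero)
  ultimately show "a - b \<in> relation_ideal S"
    by (simp add: mem_residue_class_iff)
next
  assume ab: "a - b \<in> relation_ideal S"
  have "c - a \<in> relation_ideal S \<longleftrightarrow> c - b \<in> relation_ideal S" for c
    using relation_ideal_add[OF _ ab, of "c - a"] relation_ideal_diff[OF _ ab, of "c - b"] by auto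
  then show "residue_class S a = residue_class S b"
    by (auto simp: mem_residue_class_iff)
qed

lemma presented_algebra_simps [simp]:
  "carrier (presented_algebra S) = range (residue_class S)"
  "residue_class S a \<otimes>\<^bsub>presented_algebra S\<^esub> residue_class S b = residue_class S (a * b)"
  "residue_class S a \<oplus>\<^bsub>presented_algebra S\<^esub> residue_class S b = residue_class S (a + b)"
  "\<one>\<^bsub>presented_algebra S\<^esub> = residue_class S 1"
  "c \<odot>\<^bsub>presented_algebra S\<^esub> residue_class S a = residue_class S (scalar c * a)"
proof -
  interpret ideal "relation_ideal S" free_ring by (rule ideal_relation_ideal)
  note presented = presented_algebra_def Let_def ring.extend_def module.fields_def
  show "carrier (presented_algebra S) = range (residue_class S)"
    by (auto simp: presented FactRing_def A_RCOSETS_def')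
  show "residue_class S a \<otimes>\<^bsub>presented_algebra S\<^esub> residue_class S b = residue_class S (a * b)"
    "c \<odot>\<^bsub>presented_algebra S\<^esub> residue_class S a = residue_class S (scalar c * a)"
    using rcoset_mult_add[of a b] rcoset_mult_add[of "scalar c" a]
    by (simp_all add: presented FactRing_def)
  show "residue_class S a \<oplus>\<^bsub>presented_algebra S\<^esub> residue_class S b = residue_class S (a + b)"
    using a_rcos_sum[of a b] by (simp add: presented FactRing_def)
  show "\<one>\<^bsub>presented_algebra S\<^esub> = residue_class S 1"
    by (simp add: presented FactRing_def)
qed

lemma relation_ideal_subset:
  assumes "S \<subseteq> J" and "0 \<in> J" and "\<And>a b. a \<in> J \<Longrightarrow> b \<in> J \<Longrightarrow> a + b \<in> J"
    and "\<And>a c. a \<in> J \<Longrightarrow> c * a \<in> J" and "\<And>a c. a \<in> J \<Longrightarrow> a * c \<in> J"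
  shows "relation_ideal S \<subseteq> J"
proof (rule free_ring.genideal_minimal)
  have uminus: "\<ominus>\<^bsub>free_ring\<^esub> a = - a" for a :: "('a, 'b) free_algebra"
    by (rule free_ring.minus_equality) simp_all
  \<comment> \<open>Additive inverses are products with \<open>- 1\<close>.\<close>
  have "inv\<^bsub>add_monoid free_ring\<^esub> a \<in> J" if "a \<in> J" for a
    using assms(4)[OF that, of "- 1"] uminus[of a] by (simp add: a_inv_def del: ring_of_type_algebra_simps)
  then have "subgroup J (add_monoid free_ring)"
    using assms(2,3) by (intro group.subgroupI[OF free_ring.a_group]) auto
  then show "ideal J free_ring"
    by (rule idealI[OF free_ring.ring_axioms]) (simp_all add: assms(4,5))
qed (rule assms(1))

lemma (in central_hom) alg_eval_relation_ideal:
  assumes "\<And>s. s \<in> S \<Longrightarrow> alg_eval \<iota> h s = 0" and "a \<in> relation_ideal S"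
  shows "alg_eval \<iota> h a = 0"
proof -
  have "relation_ideal S \<subseteq> {a. alg_eval \<iota> h a = 0}"
    by (rule relation_ideal_subset) (simp_all add: assms(1) subset_iff)
  then show ?thesis using assms(2) by blast
qed

section \<open>Isomorphisms as substitutions between free algebras\<close>

lemma alg_eval_scalar_relation_ideal:
  assumes "\<And>s. s \<in> S \<Longrightarrow> alg_eval scalar g s \<in> relation_ideal S'" and "a \<in> relation_ideal S"
  shows "alg_eval scalar g a \<in> relation_ideal S'"
proof -
  have "relation_ideal S \<subseteq> {a. alg_eval scalar g a \<in> relation_ideal S'}"
    by (rule relation_ideal_subset) (simp_all add: assms(1) subset_iff relation_ideal_closed)
  then show ?thesis using assms(2) by blast
qed

text \<open>Choosing a representative for the image of each generator lifts the isomorphism to a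
  substitution; that it is well defined and onto then becomes a statement modulo the relation
  ideals.\<close>

lemma algebra_isomorphic_lift:
  fixes S :: "('g, 'k::field) free_algebra set" and S' :: "('h, 'k) free_algebra set"
  assumes "algebra_isomorphic (presented_algebra S) (presented_algebra S')"
  obtains g where "\<And>a. a \<in> relation_ideal S \<Longrightarrow> alg_eval scalar g a \<in> relation_ideal S'"
    and "\<And>b. \<exists>a. b - alg_eval scalar g a \<in> relation_ideal S'"
proof -
  let ?A = "presented_algebra S" and ?B = "presented_algebra S'"
  obtain \<phi> where iso: "\<phi> \<in> ring_iso ?A ?B"
    and smult: "\<And>c a. \<phi> (residue_class S (scalar c * a)) = c \<odot>\<^bsub>?B\<^esub> \<phi> (residue_class S a)"
    using assms by (fastforce simp: algebra_isomorphic_def algebra_iso_def)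
  have closed: "\<exists>b. \<phi> (residue_class S a) = residue_class S' b" for a
    using ring_iso_memE(1)[OF iso, of "residue_class S a"] by auto
  have mult: "\<phi> (residue_class S (a * b)) = \<phi> (residue_class S a) \<otimes>\<^bsub>?B\<^esub> \<phi> (residue_class S b)" for a b
    using ring_iso_memE(2)[OF iso, of "residue_class S a" "residue_class S b"] by simp
  have add: "\<phi> (residue_class S (a + b)) = \<phi> (residue_class S a) \<oplus>\<^bsub>?B\<^esub> \<phi> (residue_class S b)" for a b
    using ring_iso_memE(3)[OF iso, of "residue_class S a" "residue_class S b"] by simp
  have one: "\<phi> (residue_class S 1) = residue_class S' 1"
    using ring_iso_memE(4)[OF iso] by simp
  define g where "g i = (SOME b. \<phi> (residue_class S (gen i)) = residue_class S' b)" for i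
  have g: "\<phi> (residue_class S (gen i)) = residue_class S' (g i)" for i
    unfolding g_def by (rule someI_ex) (rule closed)
  have \<phi>: "\<phi> (residue_class S a) = residue_class S' (alg_eval scalar g a)" for a
  proof (induction a rule: free_algebra_induct)
    case (scalar c)
    show ?case using smult[of c 1] by (simp add: one)
  qed (simp_all add: mult add g)
  show thesis
  proof
    fix a assume "a \<in> relation_ideal S"
    then have "residue_class S a = residue_class S 0"
      by (simp add: residue_class_eq_iff)
    then have "residue_class S' (alg_eval scalar g a) = residue_class S' (alg_eval scalar g 0)"
      by (metis \<phi>)
    then show "alg_eval scalar g a \<in> relation_ideal S'"
      by (simp add: residue_class_eq_iff)
  next
    fix b
    have "residue_class S' b \<in> \<phi> ` carrier ?A"
      using ring_iso_memE(5)[OF iso] by (auto simp: bij_betw_def)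
    then obtain a where "residue_class S' b = \<phi> (residue_class S a)"
      by auto
    then show "\<exists>a. b - alg_eval scalar g a \<in> relation_ideal S'"
      by (auto simp: \<phi> residue_class_eq_iff)
  qed
qed

text \<open>Lets a character of \<open>GH\<close> be carried to \<open>H(f)\<close>, besides
  representations of \<open>H(f)\<close> to \<open>GH\<close>.\<close>

lemma algebra_isomorphic_sym:
  fixes S :: "('g, 'k::field) free_algebra set" and S' :: "('h, 'k) free_algebra set"
  assumes "algebra_isomorphic (presented_algebra S) (presented_algebra S')"
  shows "algebra_isomorphic (presented_algebra S') (presented_algebra S)"
proof -
  let ?A = "presented_algebra S" and ?B = "presented_algebra S'"
  obtain \<phi> where iso: "\<phi> \<in> ring_iso ?A ?B"
    and smult: "\<And>c a. a \<in> carrier ?A \<Longrightarrow> \<phi> (c \<odot>\<^bsub>?A\<^esub> a) = c \<odot>\<^bsub>?B\<^esub> \<phi> a"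
    using assms unfolding algebra_isomorphic_def algebra_iso_def by blast
  have bij: "bij_betw \<phi> (range (residue_class S)) (range (residue_class S'))"
    using ring_iso_memE(5)[OF iso] by simp
  let ?\<psi> = "inv_into (range (residue_class S)) \<phi>"
  have \<psi>\<phi>: "?\<psi> (\<phi> (residue_class S a)) = residue_class S a" for a
    using bij by (intro bij_betw_inv_into_left) auto
  have surj: "\<exists>a. residue_class S' b = \<phi> (residue_class S a)" for b
  proof -
    have "residue_class S' b \<in> \<phi> ` range (residue_class S)"
      using bij by (simp add: bij_betw_def)
    then show ?thesis by auto
  qed
  have carrier_B: "\<exists>a. x = \<phi> (residue_class S a)" if "x \<in> carrier ?B" for x
    using that surj by auto
  have \<phi>: "\<phi> (residue_class S a) \<otimes>\<^bsub>?B\<^esub> \<phi> (residue_class S b) = \<phi> (residue_class S (a * b))"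
      "\<phi> (residue_class S a) \<oplus>\<^bsub>?B\<^esub> \<phi> (residue_class S b) = \<phi> (residue_class S (a + b))"
      "c \<odot>\<^bsub>?B\<^esub> \<phi> (residue_class S a) = \<phi> (residue_class S (scalar c * a))"
      "residue_class S' 1 = \<phi> (residue_class S 1)" for a b c
    using ring_iso_memE(2,3)[OF iso, of "residue_class S a" "residue_class S b"]
      smult[of "residue_class S a" c] ring_iso_memE(4)[OF iso] by simp_all
  have "?\<psi> \<in> ring_iso ?B ?A"
  proof (rule ring_iso_memI)
    show "bij_betw ?\<psi> (carrier ?B) (carrier ?A)"
      using bij_betw_inv_into[OF bij] by simp
    show "?\<psi> \<one>\<^bsub>?B\<^esub> = \<one>\<^bsub>?A\<^esub>"
      by (simp add: \<phi>(4) \<psi>\<phi>)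
  next
    fix x y assume "x \<in> carrier ?B" "y \<in> carrier ?B"
    then obtain a b where ab: "x = \<phi> (residue_class S a)" "y = \<phi> (residue_class S b)"
      using carrier_B by meson
    show "?\<psi> x \<in> carrier ?A" "?\<psi> (x \<otimes>\<^bsub>?B\<^esub> y) = ?\<psi> x \<otimes>\<^bsub>?A\<^esub> ?\<psi> y"
      "?\<psi> (x \<oplus>\<^bsub>?B\<^esub> y) = ?\<psi> x \<oplus>\<^bsub>?A\<^esub> ?\<psi> y"
      by (simp_all add: ab \<phi> \<psi>\<phi>)
  qed
  moreover have "?\<psi> (c \<odot>\<^bsub>?B\<^esub> x) = c \<odot>\<^bsub>?A\<^esub> ?\<psi> x" if "x \<in> carrier ?B" for x c
  proof -
    obtain a where "x = \<phi> (residue_class S a)"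
      using carrier_B \<open>x \<in> carrier ?B\<close> by meson
    then show ?thesis by (simp add: \<phi> \<psi>\<phi>)
  qed
  ultimately show ?thesis
    by (auto simp: algebra_isomorphic_def algebra_iso_def simp del: presented_algebra_simps(1))
qed

text \<open>Representations pull back along the lifted isomorphism, and surjectivity keeps the image
  unchanged. All obstructions to isomorphism below rest on this transfer.\<close>

lemma (in central_hom) algebra_isomorphic_alg_eval:
  fixes S :: "('g, 'k) free_algebra set" and S' :: "('h, 'k) free_algebra set"
  assumes iso: "algebra_isomorphic (presented_algebra S) (presented_algebra S')"
    and h': "\<And>s. s \<in> S' \<Longrightarrow> alg_eval \<iota> h' s = 0"
  obtains h where "\<And>s. s \<in> S \<Longrightarrow> alg_eval \<iota> h s = 0"
    and "range (alg_eval \<iota> h) = range (alg_eval \<iota> h')"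
proof -
  obtain g where g: "\<And>a. a \<in> relation_ideal S \<Longrightarrow> alg_eval scalar g a \<in> relation_ideal S'"
    and surj: "\<And>b. \<exists>a. b - alg_eval scalar g a \<in> relation_ideal S'"
    using algebra_isomorphic_lift[OF iso] by metis
  note kill = alg_eval_relation_ideal[OF h']
  show thesis
  proof
    show "alg_eval \<iota> (\<lambda>i. alg_eval \<iota> h' (g i)) s = 0" if "s \<in> S" for s
      using kill[OF _ g[OF relation_ideal_base[OF that]]] by (simp add: alg_eval_alg_eval)
    have "\<exists>a. alg_eval \<iota> h' b = alg_eval \<iota> (\<lambda>i. alg_eval \<iota> h' (g i)) a" for b
    proof -
      obtain a where "b - alg_eval scalar g a \<in> relation_ideal S'" using surj by blast
      from kill[OF _ this] show ?thesis by (auto simp: alg_eval_alg_eval)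
    qed
    moreover have "alg_eval \<iota> (\<lambda>i. alg_eval \<iota> h' (g i)) a = alg_eval \<iota> h' (alg_eval scalar g a)" for a
      by (simp add: alg_eval_alg_eval)
    ultimately show "range (alg_eval \<iota> (\<lambda>i. alg_eval \<iota> h' (g i))) = range (alg_eval \<iota> h')"
      by blast
  qed
qed

text \<open>Substitutions that respect the relations descend to the quotients, and by induction over
  the free algebra it suffices to test on generators that they are mutually inverse.\<close>

lemma algebra_isomorphicI:
  fixes S :: "('g, 'k::field) free_algebra set" and S' :: "('h, 'k) free_algebra set"
  assumes g: "\<And>s. s \<in> S \<Longrightarrow> alg_eval scalar g s \<in> relation_ideal S'"
    and g': "\<And>s. s \<in> S' \<Longrightarrow> alg_eval scalar g' s \<in> relation_ideal S"
    and g'g: "\<And>i. alg_eval scalar g' (g i) - gen i \<in> relation_ideal S"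
    and gg': "\<And>i. alg_eval scalar g (g' i) - gen i \<in> relation_ideal S'"
  shows "algebra_isomorphic (presented_algebra S) (presented_algebra S')"
proof -
  let ?A = "presented_algebra S" and ?B = "presented_algebra S'"
  have induced: "\<exists>\<phi>. \<forall>a. \<phi> (residue_class S a) = residue_class S' (alg_eval scalar g a)"
    if g: "\<And>s. s \<in> S \<Longrightarrow> alg_eval scalar g s \<in> relation_ideal S'"
    for g and S :: "('c, 'k) free_algebra set" and S' :: "('d, 'k) free_algebra set"
  proof (intro exI allI)
    fix a
    let ?b = "SOME b. residue_class S a = residue_class S b"
    have "residue_class S a = residue_class S ?b" by (rule someI) simp
    then have "a - ?b \<in> relation_ideal S" by (simp only: residue_class_eq_iff)
    with g have "alg_eval scalar g (a - ?b) \<in> relation_ideal S'"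
      by (rule alg_eval_scalar_relation_ideal)
    then show "(\<lambda>A. residue_class S' (alg_eval scalar g (SOME b. A = residue_class S b)))
        (residue_class S a) = residue_class S' (alg_eval scalar g a)"
      by (metis residue_class_eq_iff scalar.alg_eval_diff)
  qed
  obtain \<phi> where \<phi>: "\<And>a. \<phi> (residue_class S a) = residue_class S' (alg_eval scalar g a)"
    using induced[OF g] by blast
  obtain \<psi> where \<psi>: "\<And>a. \<psi> (residue_class S' a) = residue_class S (alg_eval scalar g' a)"
    using induced[OF g'] by blast
  \<comment> \<open>Stated for an arbitrary pair of substitutions, so that it serves both
    composites.\<close>
  have inverse: "residue_class S (alg_eval scalar g' (alg_eval scalar g a)) = residue_class S a"
    if "\<And>i. alg_eval scalar g' (g i) - gen i \<in> relation_ideal S"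
    for g g' a and S :: "('c, 'k) free_algebra set" and type :: "'d itself"
  proof (induction a rule: free_algebra_induct)
    case (gen_mult i a)
    have "residue_class S (alg_eval scalar g' (alg_eval scalar g (gen i))) = residue_class S (gen i)"
      using that by (simp add: residue_class_eq_iff)
    with gen_mult show ?case
      by (simp flip: presented_algebra_simps(2))
  next
    case (add a b)
    then show ?case
      by (simp flip: presented_algebra_simps(3))
  qed simp
  have "bij_betw \<phi> (carrier ?A) (carrier ?B)"
    by (rule bij_betw_byWitness[where f' = \<psi>])
      (auto simp: \<phi> \<psi> inverse[OF g'g] inverse[OF gg'])
  then have "\<phi> \<in> algebra_iso ?A ?B"
    by (auto simp: algebra_iso_def ring_iso_def ring_hom_def \<phi>)
  then show ?thesis
    by (auto simp: algebra_isomorphic_def)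
qed

section \<open>Non-isomorphism\<close>

definition gaddis_relations :: "'k::field \<Rightarrow> 'k \<Rightarrow> (generator, 'k) free_algebra set" where
  "gaddis_relations p q =
    {gen Gen_y * gen Gen_x - scalar q * gen Gen_x * gen Gen_y - gen Gen_t,
     gen Gen_x * gen Gen_t - scalar p * gen Gen_t * gen Gen_x,
     gen Gen_y * gen Gen_t - scalar (inverse p) * gen Gen_t * gen Gen_y}"

definition generalized_relations :: "'k::field poly \<Rightarrow> (generator, 'k) free_algebra set" where
  "generalized_relations f =
    {gen Gen_t * gen Gen_x - gen Gen_x * poly_at f (gen Gen_t),
     gen Gen_y * gen Gen_t - poly_at f (gen Gen_t) * gen Gen_y,
     gen Gen_y * gen Gen_x - gen Gen_x * gen Gen_y - (poly_at f (gen Gen_t) - gen Gen_t)}"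

lemma gaddis_heisenberg_eq: "gaddis_heisenberg p q = presented_algebra (gaddis_relations p q)"
  by (simp add: gaddis_heisenberg_def gaddis_relations_def Let_def)

lemma generalized_heisenberg_eq:
  "generalized_heisenberg f = presented_algebra (generalized_relations f)"
  by (simp add: generalized_heisenberg_def generalized_relations_def Let_def)

section \<open>Representations of the two families and their images\<close>

context central_hom
begin

text \<open>Counterpart of \<open>poly_at\<close> in an arbitrary, possibly noncommutative,
  algebra.\<close>

definition poly_val :: "'k poly \<Rightarrow> 'r \<Rightarrow> 'r" where
  "poly_val f u = (\<Sum>i\<le>Polynomial.degree f. \<iota> (Polynomial.coeff f i) * u ^ i)"

lemma poly_val_bound:
  assumes "Polynomial.degree f \<le> n"
  shows "poly_val f u = (\<Sum>i\<le>n. \<iota> (Polynomial.coeff f i) * u ^ i)"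
  unfolding poly_val_def
  by (rule sum.mono_neutral_left) (use assms in \<open>auto simp: zero Polynomial.coeff_eq_0\<close>)

lemma poly_val_0 [simp]: "poly_val 0 u = 0"
  by (simp add: poly_val_def zero)

lemma poly_val_pCons [simp]: "poly_val (pCons a f) u = \<iota> a + u * poly_val f u"
proof -
  let ?n = "Polynomial.degree f"
  \<comment> \<open>The sum is padded to \<open>Suc ?n\<close> because for \<open>f = 0\<close> the
    degree of \<open>pCons a f\<close> is \<open>0\<close>, not \<open>1\<close>.\<close>
  have "poly_val (pCons a f) u = (\<Sum>i\<le>Suc ?n. \<iota> (Polynomial.coeff (pCons a f) i) * u ^ i)"
    by (rule poly_val_bound) (simp add: degree_pCons_le)
  also have "\<dots> = \<iota> a + (\<Sum>i\<le>?n. \<iota> (Polynomial.coeff f i) * (u * u ^ i))"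
    by (subst sum.atMost_Suc_shift) simp
  also have "\<dots> = \<iota> a + u * poly_val f u"
    by (simp add: poly_val_def sum_distrib_left left_central)
  finally show ?thesis .
qed

lemma alg_eval_poly_at [simp]: "alg_eval \<iota> h (poly_at f a) = poly_val f (alg_eval \<iota> h a)"
  by (simp add: poly_at_def poly_val_def)

lemma alg_eval_gaddis_relations_iff:
  "(\<forall>s\<in>gaddis_relations p q. alg_eval \<iota> h s = 0) \<longleftrightarrow>
    h Gen_y * h Gen_x = \<iota> q * h Gen_x * h Gen_y + h Gen_t \<and>
    h Gen_x * h Gen_t = \<iota> p * h Gen_t * h Gen_x \<and>
    h Gen_y * h Gen_t = \<iota> (inverse p) * h Gen_t * h Gen_y"
  by (auto simp: gaddis_relations_def algebra_simps)

lemma alg_eval_generalized_relations_iff: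
  "(\<forall>s\<in>generalized_relations f. alg_eval \<iota> h s = 0) \<longleftrightarrow>
    h Gen_t * h Gen_x = h Gen_x * poly_val f (h Gen_t) \<and>
    h Gen_y * h Gen_t = poly_val f (h Gen_t) * h Gen_y \<and>
    h Gen_y * h Gen_x - h Gen_x * h Gen_y = poly_val f (h Gen_t) - h Gen_t"
  by (auto simp: generalized_relations_def)

definition unital_subalgebra :: "'r set \<Rightarrow> bool" where
  "unital_subalgebra B \<longleftrightarrow> range \<iota> \<subseteq> B \<and> (\<forall>u\<in>B. \<forall>v\<in>B. u + v \<in> B \<and> u * v \<in> B)"

text \<open>
  The last clause says that the images \<open>t', x', y'\<close> of the generators of \<open>GH\<^sub>p\<^sub>,\<^sub>q\<close> generate the same
  subalgebra as \<open>t, x, y\<close>.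
\<close>

lemma gaddis_generators:
  assumes iso: "algebra_isomorphic (gaddis_heisenberg p q) (generalized_heisenberg f)"
    and "t * x = x * poly_val f t" and "y * t = poly_val f t * y"
    and "y * x - x * y = poly_val f t - t"
  obtains t' x' y' where "y' * x' = \<iota> q * x' * y' + t'" and "x' * t' = \<iota> p * t' * x'"
    and "y' * t' = \<iota> (inverse p) * t' * y'"
    and "\<And>B. unital_subalgebra B \<Longrightarrow> {t', x', y'} \<subseteq> B \<longleftrightarrow> {t, x, y} \<subseteq> B"
proof -
  let ?h' = "case_generator t x y"
  have "\<forall>s\<in>generalized_relations f. alg_eval \<iota> ?h' s = 0"
    unfolding alg_eval_generalized_relations_iff using assms by simp
  then obtain h where h: "\<forall>s\<in>gaddis_relations p q. alg_eval \<iota> h s = 0"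
    and range: "range (alg_eval \<iota> h) = range (alg_eval \<iota> ?h')"
    using algebra_isomorphic_alg_eval[OF iso[unfolded gaddis_heisenberg_eq generalized_heisenberg_eq]]
    by metis
  \<comment> \<open>The image of \<open>alg_eval\<close> is the least unital subalgebra containing
    the images of the generators.\<close>
  have *: "range (alg_eval \<iota> g) \<subseteq> B \<longleftrightarrow> {g Gen_t, g Gen_x, g Gen_y} \<subseteq> B"
    if "unital_subalgebra B" for B and g :: "generator \<Rightarrow> 'r"
  proof
    assume "range (alg_eval \<iota> g) \<subseteq> B"
    then have "alg_eval \<iota> g (gen i) \<in> B" for i by blast
    then show "{g Gen_t, g Gen_x, g Gen_y} \<subseteq> B" by simp
  next
    assume "{g Gen_t, g Gen_x, g Gen_y} \<subseteq> B"
    then have "g i \<in> B" for i by (cases i) auto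
    then show "range (alg_eval \<iota> g) \<subseteq> B"
      by (intro range_alg_eval_subset) (use that in \<open>auto simp: unital_subalgebra_def\<close>)
  qed
  show thesis
  proof
    show "{h Gen_t, h Gen_x, h Gen_y} \<subseteq> B \<longleftrightarrow> {t, x, y} \<subseteq> B" if "unital_subalgebra B" for B
      using *[OF that, of h] *[OF that, of ?h'] range by simp
  qed (use h in \<open>simp_all add: alg_eval_gaddis_relations_iff\<close>)
qed

end

section \<open>Characters and fixed points of \<open>f\<close>\<close>

interpretation ident: central_hom "\<lambda>c :: 'k::field. c"
  by unfold_locales simp_all

lemma ident_poly_val [simp]: "ident.poly_val f r = poly f r"
  by (induction f) simp_all

text \<open>The relations of \<open>GH\<close> have no constant term, so all generators may go to
  \<open>0\<close>. Under the character of \<open>H(f)\<close> obtained from this, the commutator of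
  \<open>y\<close> and \<open>x\<close> vanishes, and the third relation makes the value of
  \<open>t\<close> a fixed point.\<close>

lemma algebra_isomorphic_fixed_point:
  fixes p q :: "'k::field"
  assumes "algebra_isomorphic (gaddis_heisenberg p q) (generalized_heisenberg f)"
  obtains r where "poly f r = r"
proof -
  have "\<forall>s\<in>gaddis_relations p q. alg_eval (\<lambda>c. c) (\<lambda>_. 0) s = 0"
    by (simp add: ident.alg_eval_gaddis_relations_iff)
  then obtain h where "\<forall>s\<in>generalized_relations f. alg_eval (\<lambda>c. c) h s = 0"
    using ident.algebra_isomorphic_alg_eval[OF algebra_isomorphic_sym
        [OF assms[unfolded gaddis_heisenberg_eq generalized_heisenberg_eq]]]
    by metis
  then have "poly f (h Gen_t) = h Gen_t"
    by (simp add: ident.alg_eval_generalized_relations_iff mult.commute)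
  then show thesis by (rule that)
qed

section \<open>The case \<open>p \<noteq> 1\<close>, \<open>q \<noteq> 1\<close>: the quotient
  \<open>K[x, y]\<close>\<close>

interpretation poly2: central_hom "\<lambda>c :: 'k::field. [:[:c:]:]"
  by unfold_locales (simp_all add: one_pCons ac_simps)

lemma poly2_poly_val_const: "poly2.poly_val f [:[:r:]:] = [:[:poly f r:]:]"
  by (induction f) simp_all

text \<open>Derivative at the origin in the direction \<open>v\<close>; the outer variable is
  \<open>x\<close>, the inner one \<open>y\<close>.\<close>

definition gradient_at_0 :: "'k::field \<times> 'k \<Rightarrow> 'k poly poly \<Rightarrow> 'k" where
  "gradient_at_0 v P = fst v * Polynomial.coeff (Polynomial.coeff P 1) 0
     + snd v * Polynomial.coeff (Polynomial.coeff P 0) 1"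

lemma gradient_at_0_mult:
  "gradient_at_0 v (P * Q) =
    Polynomial.coeff (Polynomial.coeff P 0) 0 * gradient_at_0 v Q
    + gradient_at_0 v P * Polynomial.coeff (Polynomial.coeff Q 0) 0"
  by (simp add: gradient_at_0_def Polynomial.coeff_mult algebra_simps)

text \<open>By the Leibniz rule the kernel of a derivation at a point is a subalgebra. For
  \<open>v\<close> nonzero it omits \<open>x\<close> or \<open>y\<close>, so elements inside it
  cannot generate \<open>K[x, y]\<close>.\<close>

lemma unital_subalgebra_gradient_at_0: "poly2.unital_subalgebra {P. gradient_at_0 v P = 0}"
  unfolding poly2.unital_subalgebra_def
  by (auto simp: gradient_at_0_mult) (auto simp: gradient_at_0_def algebra_simps)

text \<open>This is one linear condition on a two-dimensional space of directions.\<close>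

lemma gradient_at_0_nontrivial_zero: "\<exists>v. v \<noteq> (0, 0) \<and> gradient_at_0 v P = 0"
proof (cases "gradient_at_0 (1, 0) P = 0")
  case True
  then show ?thesis by (intro exI[of _ "(1, 0)"]) simp
next
  case False
  let ?v = "(gradient_at_0 (0, 1) P, - gradient_at_0 (1, 0) P)"
  have "?v \<noteq> (0, 0) \<and> gradient_at_0 ?v P = 0"
    using False by (simp add: gradient_at_0_def)
  then show ?thesis by blast
qed

lemma not_isomorphic_if_both_neq_1:
  fixes p q :: "'k::field"
  assumes "p \<noteq> 1" and "q \<noteq> 1"
  shows "\<not> algebra_isomorphic (gaddis_heisenberg p q) (generalized_heisenberg f)"
proof
  assume iso: "algebra_isomorphic (gaddis_heisenberg p q) (generalized_heisenberg f)"
  then obtain r where r: "poly f r = r"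
    by (rule algebra_isomorphic_fixed_point)
  let ?x = "[:0, 1:] :: 'k poly poly" and ?y = "[:[:0, 1:]:] :: 'k poly poly"
  obtain t' x' y' where yx': "y' * x' = [:[:q:]:] * x' * y' + t'" and xt': "x' * t' = [:[:p:]:] * t' * x'"
    and gens: "\<And>B. poly2.unital_subalgebra B \<Longrightarrow> {t', x', y'} \<subseteq> B \<longleftrightarrow> {[:[:r:]:], ?x, ?y} \<subseteq> B"
    by (rule poly2.gaddis_generators[OF iso, of "[:[:r:]:]" ?x ?y])
      (simp_all add: poly2_poly_val_const r)
  have t': "t' = [:[:1 - q:]:] * (x' * y')"
  proof -
    have "t' = (1 - [:[:q:]:]) * (x' * y')" using yx' by (simp add: algebra_simps)
    then show ?thesis by (simp add: one_pCons)
  qed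
  \<comment> \<open>As \<open>p \<noteq> 1\<close>, either \<open>x'\<close> or \<open>t'\<close>
    vanishes. Since \<open>t'\<close> is a nonzero multiple of \<open>x' * y'\<close>, both cases
    give \<open>t' = 0\<close> and \<open>x' * y' = 0\<close>.\<close>
  have "(1 - [:[:p:]:]) * (x' * t') = 0"
    using xt' by (simp add: algebra_simps)
  moreover have "1 - [:[:p:]:] \<noteq> (0 :: 'k poly poly)" and "[:[:1 - q:]:] \<noteq> (0 :: 'k poly poly)"
    using assms by (simp_all add: one_pCons)
  ultimately have xy': "x' = 0 \<or> y' = 0" and "t' = 0"
    using t' by auto
  \<comment> \<open>At most one of \<open>x'\<close>, \<open>y'\<close> is nonzero, so a direction
    annihilating the sum annihilates both.\<close>
  obtain v where "v \<noteq> (0, 0)" and "gradient_at_0 v (x' + y') = 0"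
    using gradient_at_0_nontrivial_zero by blast
  with xy' \<open>t' = 0\<close> have "{t', x', y'} \<subseteq> {P. gradient_at_0 v P = 0}"
    by (auto simp: gradient_at_0_def)
  then have "gradient_at_0 v ?x = 0" and "gradient_at_0 v ?y = 0"
    using gens[OF unital_subalgebra_gradient_at_0] by auto
  with \<open>v \<noteq> (0, 0)\<close> show False
    by (simp add: gradient_at_0_def prod_eq_iff)
qed

section \<open>The case \<open>p = q = 1\<close>: upper triangular matrices\<close>

text \<open>
  \<open>UT a b1 b2 b3 d\<close> stands for the upper triangular matrix with diagonal \<open>a, d\<close> and the vector
  \<open>(b1, b2, b3)\<close> in the corner. Those with \<open>a = d\<close> form the square-zero extension of \<open>'k\<close> by
  \<open>'k\<^sup>3\<close>.
\<close>

datatype 'k ut = UT (diag1: 'k) (corner1: 'k) (corner2: 'k) (corner3: 'k) (diag2: 'k)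

instantiation ut :: (comm_ring_1) ring_1
begin

definition "0 = UT 0 0 0 0 0"

definition "1 = UT 1 0 0 0 1"

definition "u + v = UT (diag1 u + diag1 v) (corner1 u + corner1 v) (corner2 u + corner2 v)
  (corner3 u + corner3 v) (diag2 u + diag2 v)"

definition "- u = UT (- diag1 u) (- corner1 u) (- corner2 u) (- corner3 u) (- diag2 u)"

definition "u - v = UT (diag1 u - diag1 v) (corner1 u - corner1 v) (corner2 u - corner2 v)
  (corner3 u - corner3 v) (diag2 u - diag2 v)"

definition "u * v = UT (diag1 u * diag1 v)
  (diag1 u * corner1 v + corner1 u * diag2 v) (diag1 u * corner2 v + corner2 u * diag2 v)
  (diag1 u * corner3 v + corner3 u * diag2 v) (diag2 u * diag2 v)"

lemmas ut_defs = zero_ut_def one_ut_def plus_ut_def uminus_ut_def minus_ut_def times_ut_def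

instance
  by standard (simp_all add: ut_defs algebra_simps)

end

interpretation ut: central_hom "\<lambda>c :: 'k::field. UT c 0 0 0 c"
  by unfold_locales (simp_all add: ut_defs mult.commute)

text \<open>Taylor expansion to first order: the matrix is \<open>r\<close> plus an element of
  square zero.\<close>

lemma ut_poly_val: "ut.poly_val f (UT r 1 0 0 r) = UT (poly f r) (poly (pderiv f) r) 0 0 (poly f r)"
  by (induction f) (simp_all add: ut_defs pderiv_pCons)

text \<open>
  If \<open>f(r) = r\<close> and \<open>f'(r) \<noteq> 1\<close>, then \<open>H(f)\<close> has an indecomposable noncommutative representation
  with the distinct characters \<open>(t, x, y) = (r, 1, 0)\<close> and \<open>(r, f'(r), 0)\<close> on the diagonal, while
  the centrality of \<open>t = yx - xy\<close> forbids this for \<open>GH\<^sub>1\<^sub>,\<^sub>1\<close>.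
\<close>

lemma pderiv_eq_1_at_fixed_point:
  fixes f :: "'k::field poly"
  assumes iso: "algebra_isomorphic (gaddis_heisenberg 1 1) (generalized_heisenberg f)"
    and r: "poly f r = r"
  shows "poly (pderiv f) r = 1"
proof (rule ccontr)
  assume a: "poly (pderiv f) r \<noteq> 1"
  let ?a = "poly (pderiv f) r"
  let ?t = "UT r 1 0 0 r" and ?x = "UT 1 0 0 0 ?a" and ?y = "UT 0 1 0 0 0"
  obtain t' x' y' where yx': "y' * x' = UT 1 0 0 0 1 * x' * y' + t'"
    and xt': "x' * t' = UT 1 0 0 0 1 * t' * x'" and yt': "y' * t' = UT (inverse 1) 0 0 0 (inverse 1) * t' * y'"
    and gens: "\<And>B. ut.unital_subalgebra B \<Longrightarrow> {t', x', y'} \<subseteq> B \<longleftrightarrow> {?t, ?x, ?y} \<subseteq> B"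
    by (rule ut.gaddis_generators[OF iso, of ?t ?x ?y]) (simp_all add: ut_poly_val r ut_defs)
  note one = one_ut_def[symmetric]
  have t': "t' = y' * x' - x' * y'" and comm: "x' * t' = t' * x'" "y' * t' = t' * y'"
    using yx' xt' yt' by (simp_all add: one)
  have "ut.unital_subalgebra {u. diag1 u = diag2 u}"
    by (auto simp: ut.unital_subalgebra_def ut_defs)
  moreover have "diag1 t' = diag2 t'"
    by (simp add: t' ut_defs mult.commute)
  \<comment> \<open>Otherwise \<open>?x\<close> would lie in this subalgebra too, but its diagonal
    entries are \<open>1\<close> and \<open>?a\<close>.\<close>
  ultimately have "diag1 x' \<noteq> diag2 x' \<or> diag1 y' \<noteq> diag2 y'"
    using a gens[of "{u. diag1 u = diag2 u}"] by auto
  moreover have "diag1 t' = 0" "diag2 t' = 0"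
    by (simp_all add: t' ut_defs mult.commute)
  \<comment> \<open>Only the corner of \<open>t'\<close> could be nonzero, and commuting with a
    matrix with distinct diagonal entries forces it to vanish.\<close>
  ultimately have "t' = 0"
    using comm by (cases t') (auto simp: ut_defs mult.commute)
  then have xy': "x' * y' = y' * x'"
    using t' by simp
  have centralizer: "ut.unital_subalgebra {u. u * v = v * u}" for v :: "'k ut"
  proof -
    have "(u * w) * v = v * (u * w)" if "u * v = v * u" "w * v = v * w" for u w :: "'k ut"
      by (metis that mult.assoc)
    then show ?thesis
      using ut.central[of v] by (auto simp: ut.unital_subalgebra_def distrib_left distrib_right)
  qed
  \<comment> \<open>Two passes through centralizers: first \<open>?t\<close> commutes with
    \<open>x'\<close> and \<open>y'\<close>, then \<open>?x\<close> commutes with \<open>?t\<close>,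
    although their products have corners \<open>1\<close> and \<open>?a\<close>.\<close>
  have "{t', x', y'} \<subseteq> {u. u * x' = x' * u}" "{t', x', y'} \<subseteq> {u. u * y' = y' * u}"
    by (simp_all add: xy' \<open>t' = 0\<close>)
  then have "?t \<in> {u. u * x' = x' * u}" "?t \<in> {u. u * y' = y' * u}"
    using gens[OF centralizer[of x']] gens[OF centralizer[of y']] by blast+
  then have "{t', x', y'} \<subseteq> {u. u * ?t = ?t * u}"
    unfolding \<open>t' = 0\<close> by simp
  then have "?x \<in> {u. u * ?t = ?t * u}"
    using gens[OF centralizer[of ?t]] by blast
  then have "?x * ?t = ?t * ?x" by blast
  with a show False by (simp add: times_ut_def)
qed

definition corner_functional :: "'k::field \<times> 'k \<times> 'k \<Rightarrow> 'k ut \<Rightarrow> 'k" where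
  "corner_functional v u =
    fst v * corner1 u + fst (snd v) * corner2 u + snd (snd v) * corner3 u"

text \<open>The cross product works unless it is zero; then the vectors are parallel, and a vector
  orthogonal to a nonzero one of them is orthogonal to both.\<close>

lemma common_orthogonal_vector:
  fixes a1 a2 a3 b1 b2 b3 :: "'k::field"
  shows "\<exists>v1 v2 v3. (v1, v2, v3) \<noteq> (0, 0, 0) \<and>
    v1 * a1 + v2 * a2 + v3 * a3 = 0 \<and> v1 * b1 + v2 * b2 + v3 * b3 = 0"
proof -
  let ?thesis' = "\<lambda>a1 a2 a3 b1 b2 b3 :: 'k. \<exists>v1 v2 v3. (v1, v2, v3) \<noteq> (0, 0, 0) \<and>
    v1 * a1 + v2 * a2 + v3 * a3 = 0 \<and> v1 * b1 + v2 * b2 + v3 * b3 = 0"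
  have parallel: "?thesis' a1 a2 a3 b1 b2 b3"
    if cross: "a3 * b1 = a1 * b3" "a1 * b2 = a2 * b1" and "(a1, a2, a3) \<noteq> (0, 0, 0)"
    for a1 a2 a3 b1 b2 b3 :: 'k
  proof (cases "a1 = 0 \<and> a2 = 0")
    case True
    with that have "b1 = 0" by auto
    with True show ?thesis by (intro exI[of _ 1] exI[of _ 0]) simp
  next
    case False
    with cross(2) show ?thesis
      by (intro exI[of _ a2] exI[of _ "- a1"] exI[of _ 0]) (auto simp: algebra_simps)
  qed
  consider
      "(a2 * b3 - a3 * b2, a3 * b1 - a1 * b3, a1 * b2 - a2 * b1) \<noteq> (0, 0, 0)"
    | "a2 * b3 = a3 * b2" "a3 * b1 = a1 * b3" "a1 * b2 = a2 * b1"
    by auto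
  then show ?thesis
  proof cases
    case 1
    then show ?thesis
      by (intro exI[of _ "a2 * b3 - a3 * b2"] exI[of _ "a3 * b1 - a1 * b3"]
          exI[of _ "a1 * b2 - a2 * b1"] conjI) (assumption | simp add: algebra_simps)+
  next
    case 2
    consider "(a1, a2, a3) \<noteq> (0, 0, 0)" | "(b1, b2, b3) \<noteq> (0, 0, 0)"
      | "a1 = 0" "a2 = 0" "a3 = 0" "b1 = 0" "b2 = 0" "b3 = 0" by auto
    then show ?thesis
    proof cases
      case 1
      with 2 show ?thesis by (intro parallel)
    next
      case b: 2
      have "?thesis' b1 b2 b3 a1 a2 a3"
        by (rule parallel) (use 2 b in \<open>simp_all add: mult.commute\<close>)
      then show ?thesis by metis
    next
      case 3
      then show ?thesis by (intro exI[of _ 1]) simp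
    qed
  qed
qed

lemma corner_functional_add:
  "corner_functional v (u + w) = corner_functional v u + corner_functional v w"
  by (simp add: corner_functional_def plus_ut_def algebra_simps)

lemma corner_functional_mult:
  "corner_functional v (u * w) = diag1 u * corner_functional v w + corner_functional v u * diag2 w"
  by (simp add: corner_functional_def times_ut_def algebra_simps)

text \<open>With \<open>f'(r) = 1\<close> the relations of \<open>H(f)\<close> hold for matrices
  whose corners are the three unit vectors. On the side of \<open>GH\<close> the commutator
  \<open>t'\<close> vanishes, and the corners of \<open>x'\<close> and \<open>y'\<close> alone
  cannot span a three-dimensional space.\<close>

lemma pderiv_neq_1_at_fixed_point:
  fixes f :: "'k::field poly"
  assumes iso: "algebra_isomorphic (gaddis_heisenberg 1 1) (generalized_heisenberg f)"
    and r: "poly f r = r"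
  shows "poly (pderiv f) r \<noteq> 1"
proof
  assume a: "poly (pderiv f) r = 1"
  let ?t = "UT r 1 0 0 r" and ?x = "UT 0 0 1 0 0" and ?y = "UT 0 0 0 1 0"
  obtain t' x' y' where yx': "y' * x' = UT 1 0 0 0 1 * x' * y' + t'"
    and gens: "\<And>B. ut.unital_subalgebra B \<Longrightarrow> {t', x', y'} \<subseteq> B \<longleftrightarrow> {?t, ?x, ?y} \<subseteq> B"
    by (rule ut.gaddis_generators[OF iso, of ?t ?x ?y]) (simp_all add: ut_poly_val r a ut_defs)
  have "ut.unital_subalgebra {u. diag1 u = diag2 u}"
    by (auto simp: ut.unital_subalgebra_def ut_defs)
  from gens[OF this] have diag: "diag1 x' = diag2 x'" "diag1 y' = diag2 y'"
    by auto
  have "t' = y' * x' - x' * y'"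
    using yx' by (simp add: one_ut_def[symmetric])
  also have "\<dots> = 0"
    using diag by (simp add: ut_defs)
  finally have "t' = 0" .
  obtain v where v: "v \<noteq> (0, 0, 0)" "corner_functional v x' = 0" "corner_functional v y' = 0"
    using common_orthogonal_vector[of "corner1 x'" "corner2 x'" "corner3 x'" "corner1 y'" "corner2 y'" "corner3 y'"]
    by (force simp: corner_functional_def)
  \<comment> \<open>On equal diagonals \<open>corner_functional v\<close> obeys the Leibniz rule, so
    its kernel there is a subalgebra.\<close>
  have "ut.unital_subalgebra {u. diag1 u = diag2 u \<and> corner_functional v u = 0}"
    by (auto simp: ut.unital_subalgebra_def corner_functional_add corner_functional_mult)
      (simp_all add: corner_functional_def plus_ut_def times_ut_def)
  from gens[OF this] have "corner_functional v ?t = 0" "corner_functional v ?x = 0" "corner_functional v ?y = 0"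
    using diag v(2,3) \<open>t' = 0\<close> by (auto simp: corner_functional_def zero_ut_def)
  with v(1) show False
    by (simp add: corner_functional_def prod_eq_iff)
qed

section \<open>Isomorphisms\<close>

lemma scalar_diff: "scalar (c - d) = scalar c - scalar d"
  by (simp add: eq_diff_eq flip: scalar_add)

lemma scalar_uminus: "scalar (- c) = - scalar c"
  using scalar_diff[of 0 c] by simp

lemma scalar_mult_scalar: "scalar c * (scalar d * a) = scalar (c * d) * a"
  by (simp add: scalar_mult mult.assoc)

lemmas scalar_normalize = scalar_mult_scalar scalar_mult[symmetric] scalar.left_central[of "gen i" for i]
  scalar_central[of "gen i" for i]

lemma poly_at_linear: "poly_at [:0, c:] a = scalar c * a"
  \<comment> \<open>Horner's rule for \<open>poly_val\<close> also covers \<open>c = 0\<close>,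
    where the degree drops.\<close>
  using scalar.alg_eval_poly_at[of "\<lambda>_. a" "[:0, c:]" "gen ()"]
  by (simp add: poly_at_def scalar_central)

text \<open>Used to exhibit an explicit combination of relations and leave only an identity in the
  free algebra.\<close>

lemma relation_ideal_eqI: "a \<in> relation_ideal S \<Longrightarrow> b = a \<Longrightarrow> b \<in> relation_ideal S"
  by simp

lemma gaddis_relationsI:
  "gen Gen_y * gen Gen_x - scalar q * gen Gen_x * gen Gen_y - gen Gen_t
    \<in> relation_ideal (gaddis_relations p q)"
  "gen Gen_x * gen Gen_t - scalar p * gen Gen_t * gen Gen_x \<in> relation_ideal (gaddis_relations p q)"
  "gen Gen_y * gen Gen_t - scalar (inverse p) * gen Gen_t * gen Gen_y
    \<in> relation_ideal (gaddis_relations p q)"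
  by (auto simp: gaddis_relations_def intro: relation_ideal_base)

lemma generalized_relations_linearI:
  "gen Gen_t * gen Gen_x - scalar c * gen Gen_x * gen Gen_t
    \<in> relation_ideal (generalized_relations [:0, c:])"
  "gen Gen_y * gen Gen_t - scalar c * gen Gen_t * gen Gen_y
    \<in> relation_ideal (generalized_relations [:0, c:])"
  "gen Gen_y * gen Gen_x - gen Gen_x * gen Gen_y - scalar (c - 1) * gen Gen_t
    \<in> relation_ideal (generalized_relations [:0, c:])"
proof -
  have "gen Gen_x * (scalar c * gen Gen_t) = scalar c * gen Gen_x * gen Gen_t"
    by (simp only: scalar.left_central mult.assoc)
  then show
    "gen Gen_t * gen Gen_x - scalar c * gen Gen_x * gen Gen_t
      \<in> relation_ideal (generalized_relations [:0, c:])"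
    "gen Gen_y * gen Gen_t - scalar c * gen Gen_t * gen Gen_y
      \<in> relation_ideal (generalized_relations [:0, c:])"
    "gen Gen_y * gen Gen_x - gen Gen_x * gen Gen_y - scalar (c - 1) * gen Gen_t
      \<in> relation_ideal (generalized_relations [:0, c:])"
    by (auto simp: generalized_relations_def poly_at_linear scalar_diff left_diff_distrib
        intro!: relation_ideal_base)
qed

lemma isomorphic_if_q_eq_1:
  fixes p :: "'k::field"
  assumes "p \<noteq> 0" and "p \<noteq> 1"
  shows "algebra_isomorphic (gaddis_heisenberg p 1) (generalized_heisenberg [:0, inverse p:])"
  unfolding gaddis_heisenberg_eq generalized_heisenberg_eq
proof (rule algebra_isomorphicI)
  let ?a = "inverse p"
  let ?g = "\<lambda>k. case_generator (scalar k * gen Gen_t) (gen Gen_x) (gen Gen_y)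
    :: generator \<Rightarrow> (generator, 'k) free_algebra"
  let ?I = "relation_ideal (gaddis_relations p 1)"
  let ?J = "relation_ideal (generalized_relations [:0, ?a:])"
  \<comment> \<open>In \<open>H(p\<^sup>-\<^sup>1t)\<close> the commutator of \<open>y\<close> and
    \<open>x\<close> is \<open>k\<close> times \<open>t\<close>.\<close>
  define k where "k = ?a - 1"
  have k: "k \<noteq> 0" using assms by (simp add: k_def field_simps)
  have pk: "p * (inverse k * inverse p) = inverse k" using assms by simp
  note H = generalized_relations_linearI[of ?a, folded k_def]
  note G = gaddis_relationsI[where p = p and q = 1]
  note simps = algebra_simps scalar_normalize scalar_uminus
  show "alg_eval scalar (?g k) s \<in> ?J" if "s \<in> gaddis_relations p 1" for s
  proof -
    have "gen Gen_y * gen Gen_x - gen Gen_x * gen Gen_y - scalar k * gen Gen_t \<in> ?J"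
      by (rule H)
    moreover have "gen Gen_x * (scalar k * gen Gen_t) - scalar p * (scalar k * gen Gen_t) * gen Gen_x \<in> ?J"
      by (rule relation_ideal_eqI[OF relation_ideal_mult_left[OF H(1), of "- scalar (k * p)"]])
        (use assms in \<open>simp add: simps\<close>)
    moreover have "gen Gen_y * (scalar k * gen Gen_t) - scalar ?a * (scalar k * gen Gen_t) * gen Gen_y \<in> ?J"
      by (rule relation_ideal_eqI[OF relation_ideal_mult_left[OF H(2), of "scalar k"]])
        (simp add: simps)
    ultimately show ?thesis
      using that by (auto simp: gaddis_relations_def)
  qed
  show "alg_eval scalar (?g (inverse k)) s \<in> ?I" if "s \<in> generalized_relations [:0, ?a:]" for s
  proof -
    let ?t = "scalar (inverse k) * gen Gen_t"
    have "?t * gen Gen_x - gen Gen_x * (scalar ?a * ?t) \<in> ?I"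
      by (rule relation_ideal_eqI[OF relation_ideal_mult_left[OF G(2), of "- scalar (inverse k * ?a)"]])
        (simp add: simps pk)
    moreover have "gen Gen_y * ?t - scalar ?a * ?t * gen Gen_y \<in> ?I"
      by (rule relation_ideal_eqI[OF relation_ideal_mult_left[OF G(3), of "scalar (inverse k)"]])
        (simp add: simps)
    moreover have "gen Gen_y * gen Gen_x - gen Gen_x * gen Gen_y - (scalar ?a * ?t - ?t) \<in> ?I"
    proof (rule relation_ideal_eqI[OF G(1)])
      have "scalar ?a * ?t - ?t = scalar (k * inverse k) * gen Gen_t"
        by (simp add: k_def scalar_normalize scalar_diff left_diff_distrib mult.commute)
      then show "gen Gen_y * gen Gen_x - gen Gen_x * gen Gen_y - (scalar ?a * ?t - ?t) =
          gen Gen_y * gen Gen_x - scalar 1 * gen Gen_x * gen Gen_y - gen Gen_t"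
        using k by simp
    qed
    ultimately show ?thesis
      using that by (auto simp: generalized_relations_def poly_at_linear)
  qed
  show "alg_eval scalar (?g (inverse k)) (?g k i) - gen i \<in> ?I"
    and "alg_eval scalar (?g k) (?g (inverse k) i) - gen i \<in> ?J" for i
    using k by (cases i; simp add: relation_ideal_zero scalar_normalize)+
qed

text \<open>
  The substitution comes from the central element \<open>xy - t\<close> of \<open>H(qt)\<close>, which has to be a multiple
  of the central generator \<open>t\<close> of \<open>GH\<^sub>1\<^sub>,\<^sub>q\<close>.
\<close>

lemma isomorphic_if_p_eq_1:
  fixes q :: "'k::field"
  assumes "q \<noteq> 1"
  shows "algebra_isomorphic (gaddis_heisenberg 1 q) (generalized_heisenberg [:0, q:])"
  unfolding gaddis_heisenberg_eq generalized_heisenberg_eq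
proof (rule algebra_isomorphicI)
  define k where "k = 1 - q"
  have k: "k \<noteq> 0" using assms by (simp add: k_def)
  have q: "q = 1 - k" by (simp add: k_def)
  let ?t = "gen Gen_t :: (generator, 'k) free_algebra"
    and ?x = "gen Gen_x :: (generator, 'k) free_algebra"
    and ?y = "gen Gen_y :: (generator, 'k) free_algebra"
  \<comment> \<open>In \<open>H(qt)\<close> one has \<open>yx - q xy = k (xy - t)\<close>, which
    dictates \<open>?s\<close>; solving for \<open>t\<close> gives \<open>?s'\<close>.\<close>
  let ?s = "scalar k * (?x * ?y - ?t)" and ?s' = "?x * ?y - scalar (inverse k) * ?t"
  let ?g = "case_generator ?s ?x ?y" and ?g' = "case_generator ?s' ?x ?y"
  let ?I = "relation_ideal (gaddis_relations 1 q)"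
  let ?J = "relation_ideal (generalized_relations [:0, q:])"
  note H = generalized_relations_linearI[of q]
  note G = gaddis_relationsI[where p = 1 and q = q]
  note simps = algebra_simps scalar_normalize q scalar_diff scalar_uminus
  show "alg_eval scalar ?g s \<in> ?J" if "s \<in> gaddis_relations 1 q" for s
  proof -
    have "?y * ?x - scalar q * ?x * ?y - ?s \<in> ?J"
      by (rule relation_ideal_eqI[OF H(3)]) (simp add: simps)
    moreover have "?x * ?s - ?s * ?x \<in> ?J"
      by (rule relation_ideal_eqI[OF relation_ideal_mult_left[OF relation_ideal_diff
              [OF H(1) relation_ideal_mult_left[OF H(3), of ?x]], of "scalar k"]])
        (simp add: simps)
    moreover have "?y * ?s - ?s * ?y \<in> ?J"
      by (rule relation_ideal_eqI[OF relation_ideal_mult_left[OF relation_ideal_diff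
              [OF relation_ideal_mult_right[OF H(3), of ?y] H(2)], of "scalar k"]])
        (simp add: simps)
    ultimately show ?thesis
      using that by (auto simp: gaddis_relations_def)
  qed
  show "alg_eval scalar ?g' s \<in> ?I" if "s \<in> generalized_relations [:0, q:]" for s
  proof -
    \<comment> \<open>Because \<open>k + q = 1\<close>, the terms in \<open>t\<close> left over from
      the first relation are \<open>inverse k\<close> times the commutator of \<open>x\<close> and
      \<open>t\<close>.\<close>
    have "?s' * ?x - ?x * (scalar q * ?s') \<in> ?I"
      by (rule relation_ideal_eqI[OF relation_ideal_add
            [OF relation_ideal_mult_left[OF G(1), of ?x]
              relation_ideal_mult_left[OF G(2), of "scalar (inverse k)"]]])
        (use k in \<open>simp add: simps\<close>)
    moreover have "?y * ?s' - scalar q * ?s' * ?y \<in> ?I"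
      by (rule relation_ideal_eqI[OF relation_ideal_diff
            [OF relation_ideal_mult_right[OF G(1), of ?y]
              relation_ideal_mult_left[OF G(3), of "scalar (inverse k)"]]])
        (use k in \<open>simp add: simps\<close>)
    moreover have "?y * ?x - ?x * ?y - (scalar q * ?s' - ?s') \<in> ?I"
      by (rule relation_ideal_eqI[OF G(1)]) (use k in \<open>simp add: simps\<close>)
    ultimately show ?thesis
      using that by (auto simp: generalized_relations_def poly_at_linear)
  qed
  show "alg_eval scalar ?g' (?g i) - gen i \<in> ?I"
    and "alg_eval scalar ?g (?g' i) - gen i \<in> ?J" for i
    using k by (cases i; simp add: relation_ideal_zero scalar_normalize algebra_simps)+
qed

section \<open>The enveloping algebra of the Heisenberg Lie algebra\<close>

lemma gaddis_1_1_isomorphic_enveloping: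
  "algebra_isomorphic (gaddis_heisenberg (1::'k::field) 1)
    (enveloping_algebra (triple_scale :: 'k \<Rightarrow> _) heisenberg_bracket)"
  unfolding gaddis_heisenberg_eq enveloping_algebra_def
proof (rule algebra_isomorphicI)
  let ?t = "gen Gen_t :: (generator, 'k) free_algebra"
    and ?x = "gen Gen_x :: (generator, 'k) free_algebra"
    and ?y = "gen Gen_y :: (generator, 'k) free_algebra"
  let ?S = "{gen (u + v) - (gen u + gen v) |u v. True} \<union>
      {gen (triple_scale c u) - scalar c * gen u |c u. True} \<union>
      {gen u * gen v - gen v * gen u - gen (heisenberg_bracket u v) |u v. True}
      :: ('k \<times> 'k \<times> 'k, 'k) free_algebra set"
  let ?I = "relation_ideal (gaddis_relations (1::'k) 1)"
  let ?J = "relation_ideal ?S"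
  \<comment> \<open>Since \<open>t = yx - xy\<close> and \<open>Z = [X, Y]\<close>, the generator
    \<open>y\<close> corresponds to \<open>X\<close> and \<open>x\<close> to
    \<open>Y\<close>.\<close>
  let ?g = "case_generator (gen (0, 0, 1)) (gen (0, 1, 0)) (gen (1, 0, 0))
    :: generator \<Rightarrow> ('k \<times> 'k \<times> 'k, 'k) free_algebra"
  let ?g' = "\<lambda>(a, b, z). scalar a * ?y + scalar b * ?x + scalar z * ?t"
  have add: "gen (u + v) - (gen u + gen v) \<in> ?J" for u v
    by (rule relation_ideal_base) blast
  have scale: "gen (triple_scale c u) - scalar c * gen u \<in> ?J" for c u
    by (rule relation_ideal_base) blast
  have bracket: "gen u * gen v - gen v * gen u - gen (heisenberg_bracket u v) \<in> ?J" for u v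
    by (rule relation_ideal_base) blast
  \<comment> \<open>The generator of the zero vector is nonzero in the free algebra and vanishes
    only modulo the relations.\<close>
  have zero: "gen (0, 0, 0) \<in> ?J"
    using scale[of 0 "(0, 0, 0)"] by (simp add: triple_scale_def)
  show "alg_eval scalar ?g s \<in> ?J" if "s \<in> gaddis_relations 1 1" for s
  proof -
    have "gen (0, 1, 0) * gen (0, 0, 1) - gen (0, 0, 1) * gen (0, 1, 0) \<in> ?J"
      "gen (1, 0, 0) * gen (0, 0, 1) - gen (0, 0, 1) * gen (1, 0, 0) \<in> ?J"
      using relation_ideal_add[OF bracket[of "(0, 1, 0)" "(0, 0, 1)"] zero]
        relation_ideal_add[OF bracket[of "(1, 0, 0)" "(0, 0, 1)"] zero]
      by (simp_all add: heisenberg_bracket_def)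
    then show ?thesis
      using that bracket[of "(1, 0, 0)" "(0, 1, 0)"]
      by (auto simp: gaddis_relations_def heisenberg_bracket_def)
  qed
  have bracket': "?g' u * ?g' v - ?g' v * ?g' u - ?g' (heisenberg_bracket u v) \<in> ?I" for u v
  proof -
    obtain a b z where u: "u = (a, b, z)" by (cases u)
    obtain a' b' z' where v: "v = (a', b', z')" by (cases v)
    note G = gaddis_relationsI[where p = 1 and q = "1 :: 'k"]
    \<comment> \<open>By bilinearity the commutator combines the three basic ones, with the minors
      of the coordinates as coefficients.\<close>
    show ?thesis
      by (rule relation_ideal_eqI[OF relation_ideal_add[OF relation_ideal_add
            [OF relation_ideal_mult_left[OF G(1), of "scalar (a * b' - b * a')"]
              relation_ideal_mult_left[OF G(2), of "scalar (b * z' - z * b')"]]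
            relation_ideal_mult_left[OF G(3), of "scalar (a * z' - z * a')"]]])
        (simp add: u v heisenberg_bracket_def algebra_simps scalar_normalize scalar_diff)
  qed
  show "alg_eval scalar ?g' s \<in> ?I" if "s \<in> ?S" for s
  proof -
    have "?g' (u + v) - (?g' u + ?g' v) = 0" for u v
      by (cases u; cases v) (simp add: scalar_add algebra_simps)
    moreover have "?g' (triple_scale c u) - scalar c * ?g' u = 0" for c u
      by (cases u) (simp add: triple_scale_def scalar_normalize algebra_simps)
    ultimately show ?thesis
      using that bracket' relation_ideal_zero by auto
  qed
  show "alg_eval scalar ?g' (?g i) - gen i \<in> ?I" for i
    by (cases i) (simp_all add: relation_ideal_zero)
  show "alg_eval scalar ?g (?g' u) - gen u \<in> ?J" for u
  proof -
    obtain a b z where u: "u = (a, b, z)" by (cases u)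
    have A: "gen (a, 0, 0) - scalar a * gen (1, 0, 0) \<in> ?J" (is "?A \<in> _")
      and B: "gen (0, b, 0) - scalar b * gen (0, 1, 0) \<in> ?J" (is "?B \<in> _")
      and Z: "gen (0, 0, z) - scalar z * gen (0, 0, 1) \<in> ?J" (is "?Z \<in> _")
      using scale[of a "(1, 0, 0)"] scale[of b "(0, 1, 0)"] scale[of z "(0, 0, 1)"]
      by (simp_all add: triple_scale_def)
    have C: "gen (a, b, 0) - (gen (a, 0, 0) + gen (0, b, 0)) \<in> ?J" (is "?C \<in> _")
      and D: "gen (a, b, z) - (gen (a, b, 0) + gen (0, 0, z)) \<in> ?J" (is "?D \<in> _")
      using add[of "(a, 0, 0)" "(0, b, 0)"] add[of "(a, b, 0)" "(0, 0, z)"] by simp_all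
    \<comment> \<open>The sum telescopes to \<open>gen (a, b, z)\<close> minus its expansion in the
      basis.\<close>
    have "0 - (?A + ?B + ?Z + (?C + ?D)) \<in> ?J"
      by (rule relation_ideal_diff[OF relation_ideal_zero relation_ideal_add[OF relation_ideal_add
            [OF relation_ideal_add[OF A B] Z] relation_ideal_add[OF C D]]])
    then show ?thesis by (simp add: u algebra_simps)
  qed
qed

theorem theorem4p4:
  fixes p q :: "'k::field"
  assumes "p \<noteq> 0" and "q \<noteq> 0"
  shows "((\<exists>f :: 'k poly.
             algebra_isomorphic (gaddis_heisenberg p q) (generalized_heisenberg f)) \<longleftrightarrow>
            (p = 1 \<or> q = 1) \<and> \<not> (p = 1 \<and> q = 1)) \<and>
         algebra_isomorphic (gaddis_heisenberg (1::'k) 1)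
           (enveloping_algebra (triple_scale :: 'k \<Rightarrow> _) heisenberg_bracket) \<and>
         \<not> (\<exists>f :: 'k poly.
             algebra_isomorphic (gaddis_heisenberg 1 1) (generalized_heisenberg f))"
proof -
  \<comment> \<open>The derivative of \<open>f\<close> at the fixed point would have to be both
    equal to and different from \<open>1\<close>.\<close>
  have not_1_1: "\<not> algebra_isomorphic (gaddis_heisenberg 1 1) (generalized_heisenberg f)"
    for f :: "'k poly"
    using algebra_isomorphic_fixed_point pderiv_eq_1_at_fixed_point pderiv_neq_1_at_fixed_point
    by metis
  then show ?thesis
    using assms isomorphic_if_q_eq_1[of p] isomorphic_if_p_eq_1[of q] not_isomorphic_if_both_neq_1
      gaddis_1_1_isomorphic_enveloping
    by blast
qed

end
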